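(* Let $\omega\in\mathbb{C}$, $\omega\ne0$. The coadjoint action of $U_q(h)$ on the generators of the extended braided Heisenberg group $\widetilde{BH_q(1)}$, i.e. the action $$X\rhd u^i{}_j=\sum_{k,l}u^k{}_l\,\langle X,(S t^i{}_k)\,t^l{}_j\rangle ,\qquad X\in U_q(h),\qquad (u^i{}_j)=\begin{pmatrix}1&\alpha&\beta\\0&\gamma&\delta\\0&0&1\end{pmatrix},$$ is given (entrywise) by $$A\rhd\begin{pmatrix}1&\alpha&\beta\\0&\gamma&\delta\\0&0&1\end{pmatrix}=\begin{pmatrix}0&1-\gamma&-\delta\\0&0&0\\0&0&0\end{pmatrix},\qquad A^\dagger\rhd\begin{pmatrix}1&\alpha&\beta\\0&\gamma&\delta\\0&0&1\end{pmatrix}=\begin{pmatrix}0&0&\alpha\\0&0&\gamma-1\\0&0&0\end{pmatrix},$$ $$N\rhd\begin{pmatrix}1&\alpha&\beta\\0&\gamma&\delta\\0&0&1\end{pmatrix}=\begin{pmatrix}0&\alpha&0\\0&0&-\delta\\0&0&0\end{pmatrix},\qquad H\rhd\begin{pmatrix}1&\alpha&\beta\\0&\gamma&\delta\\0&0&1\end{pmatrix}=0 .$$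
   Context: **$U_q(h)$.** Unital algebra generated by $A,A^\dagger,N$ and a central element $H$ with its exponentials, with relations $[A,A^\dagger]=\frac1\omega(e^{\omega H/2}-e^{-\omega H/2})$, $[N,A]=-A$, $[N,A^\dagger]=A^\dagger$. Convention on exponentials: besides $H$, a central invertible element $g=e^{\omega H/4}$ is adjoined, and $e^{k\omega H/4}$ means $g^k$ ($k\in\mathbb{Z}$). Hopf structure: $\Delta A=e^{-\omega H/4}\otimes A+A\otimes e^{\omega H/4}$, $\Delta A^\dagger=e^{-\omega H/4}\otimes A^\dagger+A^\dagger\otimes e^{\omega H/4}$, $\Delta N=N\otimes1+1\otimes N$, $\Delta H=H\otimes 1+1\otimes H$, $\Delta g=g\otimes g$; $\varepsilon(X)=0$, $S(X)=-X$ for $X=A,A^\dagger,N,H$; $\varepsilon(g)=1$, $S(g)=g^{-1}$. **$\widetilde{H_q(1)}$ (extended quantum Heisenberg group).** Unital Hopf algebra generated by the entries $\alpha=t^1{}_2$, $\beta=t^1{}_3$, $\gamma=t^2{}_2$, $\delta=t^2{}_3$ (with $t^1{}_1=t^3{}_3=1$, $t^i{}_j=0$ for $i>j$) and $\gamma^{-1}$; $\gamma$ central, $\alpha\beta-\beta\alpha=\frac\omega2\alpha$, $\alpha\delta-\delta\alpha=0$, $\beta\delta-\delta\beta=-\frac\omega2\delta$; $\Delta t^i{}_j=\sum_k t^i{}_k\otimes t^k{}_j$, $\varepsilon(t^i{}_j)=\delta^i{}_j$, $S(\alpha)=-\gamma^{-1}\alpha$, $S(\beta)=-\beta+\gamma^{-1}\alpha\delta$,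 $S(\delta)=-\gamma^{-1}\delta$, $S(\gamma)=\gamma^{-1}$. **Pairing.** $\langle\ ,\ \rangle$ is the Hopf algebra pairing between $U_q(h)$ and $\widetilde{H_q(1)}$ (i.e. $\langle\phi\psi,a\rangle=\langle\phi\otimes\psi,\Delta a\rangle$, $\langle\phi,ab\rangle=\langle\Delta\phi,a\otimes b\rangle$, $\langle1,a\rangle=\varepsilon(a)$, $\langle\phi,1\rangle=\varepsilon(\phi)$, $\langle S\phi,a\rangle=\langle\phi,Sa\rangle$) determined by $\langle X,t^i{}_j\rangle=\rho(X)^i{}_j$ with $\rho(A)=e_{12}$, $\rho(A^\dagger)=e_{23}$, $\rho(H)=e_{13}$, $\rho(N)=e_{22}$ (matrix units in $M_3(\mathbb{C})$) and $\rho(e^{k\omega H/4})=1+\frac{k\omega}4e_{13}$. **$\widetilde{BH_q(1)}$ (extended braided Heisenberg group).** Unital algebra generated by $\alpha=u^1{}_2$, $\beta=u^1{}_3$, $\gamma=u^2{}_2$, $\delta=u^2{}_3$ (different from, but denoted like, those of $\widetilde{H_q(1)}$) and $\gamma^{-1}$, with $u^1{}_1=u^3{}_3=1$, $u^i{}_j=0$ for $i>j$; $\gamma$ central, $\alpha\beta-\beta\alpha=\omega\alpha$, $\alpha\delta-\delta\alpha=\omega(\gamma-1)$, $\beta\delta-\delta\beta=\omega\delta$. *)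

theory Defs
  imports
    Complex_Main
    "HOL-Algebra.QuotRing"
    "HOL-Algebra.Module"
    "HOL-Library.Poly_Mapping"
    "HOL-Library.Product_Plus"
begin

section \<open>Algebras given by generators and relations\<close>

text \<open>
  The free complex algebra on \<open>'g\<close> is the monoid algebra, with the convolution product of
  \<^theory>\<open>HOL-Library.Poly_Mapping\<close>, of the free monoid of words in \<open>'g\<close>. A separate type of words is
  used because the library writes the monoid operation additively and lists carry no such instance.
\<close>

datatype 'g gen_word = Word (letters: "'g list")

instantiation gen_word :: (type) monoid_add
begin
definition zero_gen_word :: "'a gen_word" where "0 = Word []"
definition plus_gen_word :: "'a gen_word \<Rightarrow> 'a gen_word \<Rightarrow> 'a gen_word"
  where "v + w = Word (letters v @ letters w)"
instance
  by standard (simp_all add: zero_gen_word_def plus_gen_word_def)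
end

type_synonym 'm monoid_alg = "'m \<Rightarrow>\<^sub>0 complex"
type_synonym 'g free_alg = "'g gen_word monoid_alg"

definition scalar :: "complex \<Rightarrow> ('m::monoid_add) monoid_alg"
  where "scalar c = Poly_Mapping.single 0 c"

definition basis :: "'m::monoid_add \<Rightarrow> 'm monoid_alg"
  where "basis m = Poly_Mapping.single m 1"

definition gen :: "'g \<Rightarrow> 'g free_alg"
  where "gen x = basis (Word [x])"

definition commutator :: "'a::ring_1 \<Rightarrow> 'a \<Rightarrow> 'a"
  where "commutator x y = x * y - y * x"

definition monoid_alg_ring :: "('m::monoid_add) monoid_alg ring"
  where "monoid_alg_ring = \<lparr>carrier = UNIV, mult = (*), one = 1, zero = 0, add = (+)\<rparr>"

definition rel_ideal :: "('m::monoid_add) monoid_alg set \<Rightarrow> 'm monoid_alg set"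
  where "rel_ideal R = Idl\<^bsub>monoid_alg_ring\<^esub> R"

definition cls :: "('m::monoid_add) monoid_alg set \<Rightarrow> 'm monoid_alg \<Rightarrow> 'm monoid_alg set"
  where "cls R x = rel_ideal R +>\<^bsub>monoid_alg_ring\<^esub> x"

definition quot_alg ::
  "('m::monoid_add) monoid_alg set \<Rightarrow> (complex, 'm monoid_alg set) module"
  where "quot_alg R =
    (let Q = monoid_alg_ring Quot rel_ideal R
     in ring.extend Q (module.fields (\<lambda>c X. cls R (scalar c) \<otimes>\<^bsub>Q\<^esub> X)))"

text \<open>
  A map that is defined on the monoid algebra and is constant on the cosets of the ideal descends
  to the quotient; \<open>descend f X\<close> is the common value of \<open>f\<close> on the coset \<open>X\<close>.
\<close>

definition descend :: "('a \<Rightarrow> 'b) \<Rightarrow> 'a set \<Rightarrow> 'b"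
  where "descend f X = the_elem (f ` X)"

text \<open>
  Extension of values on generators to a unital algebra homomorphism, respectively
  antihomomorphism, on the free algebra; \<open>\<iota>\<close> embeds the scalars into the target algebra.
\<close>

definition hom_ext :: "(complex \<Rightarrow> 'a::ring_1) \<Rightarrow> ('g \<Rightarrow> 'a) \<Rightarrow> 'g free_alg \<Rightarrow> 'a"
  where "hom_ext \<iota> f x =
    (\<Sum>w\<in>Poly_Mapping.keys x. \<iota> (Poly_Mapping.lookup x w) * prod_list (map f (letters w)))"

definition antihom_ext :: "(complex \<Rightarrow> 'a::ring_1) \<Rightarrow> ('g \<Rightarrow> 'a) \<Rightarrow> 'g free_alg \<Rightarrow> 'a"
  where "antihom_ext \<iota> f x =
    (\<Sum>w\<in>Poly_Mapping.keys x. \<iota> (Poly_Mapping.lookup x w) * prod_list (map f (rev (letters w))))"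

text \<open>
  The tensor product of two monoid algebras is the monoid algebra of the product monoid, with
  \<open>v \<otimes> w\<close> corresponding to the basis element \<open>(v, w)\<close>. For ideals \<open>I\<close>, \<open>J\<close> of \<open>F\<close>, \<open>G\<close> generated by
  \<open>R\<close>, \<open>R'\<close>, the tensor product \<open>F/I \<otimes> G/J\<close> is the quotient of \<open>F \<otimes> G\<close> by \<open>I \<otimes> G + F \<otimes> J\<close>, which is
  the ideal generated by \<open>tensor_rels R R'\<close>.
\<close>

definition tensor ::
  "('m::monoid_add) monoid_alg \<Rightarrow> ('n::monoid_add) monoid_alg \<Rightarrow> ('m \<times> 'n) monoid_alg"
  (infixr \<open>\<boxtimes>\<close> 75)
  where "x \<boxtimes> y = (\<Sum>v\<in>Poly_Mapping.keys x. \<Sum>w\<in>Poly_Mapping.keys y.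
    Poly_Mapping.single (v, w) (Poly_Mapping.lookup x v * Poly_Mapping.lookup y w))"

definition tensor_rels ::
  "('m::monoid_add) monoid_alg set \<Rightarrow> ('n::monoid_add) monoid_alg set \<Rightarrow> ('m \<times> 'n) monoid_alg set"
  where "tensor_rels R R' = {r \<boxtimes> 1 | r. r \<in> R} \<union> {1 \<boxtimes> r | r. r \<in> R'}"

text \<open>
  The linear functional on the tensor product of two quotient algebras that is induced by a
  bilinear form \<open>b\<close> on them.
\<close>

definition bilin_ext ::
  "('m::monoid_add) monoid_alg set \<Rightarrow> ('n::monoid_add) monoid_alg set \<Rightarrow>
   ('m monoid_alg set \<Rightarrow> 'n monoid_alg set \<Rightarrow> complex) \<Rightarrow> ('m \<times> 'n) monoid_alg set \<Rightarrow> complex"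
  where "bilin_ext R R' b = descend (\<lambda>z. \<Sum>(v, w)\<in>Poly_Mapping.keys z.
    Poly_Mapping.lookup z (v, w) * b (cls R (basis v)) (cls R' (basis w)))"


section \<open>Hopf pairings\<close>

text \<open>
  A Hopf structure on \<open>quot_alg R\<close>: comultiplication into \<open>quot_alg (tensor_rels R R)\<close>, counit and
  antipode.
\<close>

record 'm hopf_str =
  comult :: "'m monoid_alg set \<Rightarrow> ('m \<times> 'm) monoid_alg set"
  counit :: "'m monoid_alg set \<Rightarrow> complex"
  antipode :: "'m monoid_alg set \<Rightarrow> 'm monoid_alg set"

definition bilinear_form ::
  "(complex, 'a) module \<Rightarrow> (complex, 'b) module \<Rightarrow> ('a \<Rightarrow> 'b \<Rightarrow> complex) \<Rightarrow> bool"
  where "bilinear_form U V p \<longleftrightarrow>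
    (\<forall>x\<in>carrier U. \<forall>y\<in>carrier U. \<forall>a\<in>carrier V. p (x \<oplus>\<^bsub>U\<^esub> y) a = p x a + p y a) \<and>
    (\<forall>x\<in>carrier U. \<forall>a\<in>carrier V. \<forall>b\<in>carrier V. p x (a \<oplus>\<^bsub>V\<^esub> b) = p x a + p x b) \<and>
    (\<forall>c. \<forall>x\<in>carrier U. \<forall>a\<in>carrier V. p (c \<odot>\<^bsub>U\<^esub> x) a = c * p x a) \<and>
    (\<forall>c. \<forall>x\<in>carrier U. \<forall>a\<in>carrier V. p x (c \<odot>\<^bsub>V\<^esub> a) = c * p x a)"

definition hopf_pairing ::
  "('m::monoid_add) monoid_alg set \<Rightarrow> 'm hopf_str \<Rightarrow> ('n::monoid_add) monoid_alg set \<Rightarrow> 'n hopf_str \<Rightarrow>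
   ('m monoid_alg set \<Rightarrow> 'n monoid_alg set \<Rightarrow> complex) \<Rightarrow> bool"
  where "hopf_pairing R hU R' hV p \<longleftrightarrow>
    (let U = quot_alg R; V = quot_alg R' in
      bilinear_form U V p \<and>
      (\<forall>x\<in>carrier U. \<forall>y\<in>carrier U. \<forall>a\<in>carrier V.
        p (x \<otimes>\<^bsub>U\<^esub> y) a = bilin_ext R' R' (\<lambda>a' a''. p x a' * p y a'') (comult hV a)) \<and>
      (\<forall>x\<in>carrier U. \<forall>a\<in>carrier V. \<forall>b\<in>carrier V.
        p x (a \<otimes>\<^bsub>V\<^esub> b) = bilin_ext R R (\<lambda>x' x''. p x' a * p x'' b) (comult hU x)) \<and>
      (\<forall>a\<in>carrier V. p \<one>\<^bsub>U\<^esub> a = counit hV a) \<and>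
      (\<forall>x\<in>carrier U. p x \<one>\<^bsub>V\<^esub> = counit hU x) \<and>
      (\<forall>x\<in>carrier U. \<forall>a\<in>carrier V. p (antipode hU x) a = p x (antipode hV a)))"


section \<open>The quantized Heisenberg algebra\<close>

text \<open>\<open>Qg\<close> and \<open>Qginv\<close> stand for \<open>g = exp (\<omega>H/4)\<close> and its inverse.\<close>

datatype uq_gen = QA | QAd | QN | QH | Qg | Qginv

definition exp_H :: "int \<Rightarrow> uq_gen free_alg"
  where "exp_H k = (if 0 \<le> k then gen Qg ^ nat k else gen Qginv ^ nat (- k))"

definition uq_rels :: "complex \<Rightarrow> uq_gen free_alg set"
  where "uq_rels \<omega> =
    {commutator (gen QA) (gen QAd) - scalar (1 / \<omega>) * (exp_H 2 - exp_H (- 2)),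
     commutator (gen QN) (gen QA) + gen QA,
     commutator (gen QN) (gen QAd) - gen QAd,
     gen Qg * gen Qginv - 1,
     gen Qginv * gen Qg - 1} \<union>
    {commutator (gen QH) (gen x) | x. True} \<union>
    {commutator (gen Qg) (gen x) | x. True}"

fun uq_comult_gen :: "uq_gen \<Rightarrow> (uq_gen gen_word \<times> uq_gen gen_word) monoid_alg" where
  "uq_comult_gen QA = exp_H (- 1) \<boxtimes> gen QA + gen QA \<boxtimes> exp_H 1"
| "uq_comult_gen QAd = exp_H (- 1) \<boxtimes> gen QAd + gen QAd \<boxtimes> exp_H 1"
| "uq_comult_gen QN = gen QN \<boxtimes> 1 + 1 \<boxtimes> gen QN"
| "uq_comult_gen QH = gen QH \<boxtimes> 1 + 1 \<boxtimes> gen QH"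
| "uq_comult_gen Qg = gen Qg \<boxtimes> gen Qg"
| "uq_comult_gen Qginv = gen Qginv \<boxtimes> gen Qginv"

fun uq_counit_gen :: "uq_gen \<Rightarrow> complex" where
  "uq_counit_gen Qg = 1"
| "uq_counit_gen Qginv = 1"
| "uq_counit_gen _ = 0"

fun uq_antipode_gen :: "uq_gen \<Rightarrow> uq_gen free_alg" where
  "uq_antipode_gen Qg = gen Qginv"
| "uq_antipode_gen Qginv = gen Qg"
| "uq_antipode_gen x = - gen x"

definition uq_hopf :: "complex \<Rightarrow> uq_gen gen_word hopf_str"
  where "uq_hopf \<omega> =
    \<lparr>comult = descend (\<lambda>x. cls (tensor_rels (uq_rels \<omega>) (uq_rels \<omega>)) (hom_ext scalar uq_comult_gen x)),
     counit = descend (hom_ext id uq_counit_gen),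
     antipode = descend (\<lambda>x. cls (uq_rels \<omega>) (antihom_ext scalar uq_antipode_gen x))\<rparr>"


section \<open>The extended quantum and braided Heisenberg groups\<close>

datatype heis_gen = Alpha | Beta | Gamma | Delta | GammaInv

text \<open>
  Matrices are indexed from 1. Both groups have generators of the same names, so \<open>heis_mat\<close> serves as the
  matrix \<open>t\<close> (modulo \<open>hq_rels\<close>) and as the matrix \<open>u\<close> (modulo \<open>bh_rels\<close>).
\<close>

definition mat_of :: "'a list list \<Rightarrow> nat \<Rightarrow> nat \<Rightarrow> 'a"
  where "mat_of M i j = M ! (i - 1) ! (j - 1)"

definition heis_mat :: "nat \<Rightarrow> nat \<Rightarrow> heis_gen free_alg"
  where "heis_mat = mat_of
    [[1, gen Alpha, gen Beta],
     [0, gen Gamma, gen Delta],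
     [0, 0,         1]]"

definition gamma_rels :: "heis_gen free_alg set"
  where "gamma_rels =
    {gen Gamma * gen GammaInv - 1, gen GammaInv * gen Gamma - 1} \<union>
    {commutator (gen Gamma) (gen x) | x. True}"

definition hq_rels :: "complex \<Rightarrow> heis_gen free_alg set"
  where "hq_rels \<omega> = gamma_rels \<union>
    {commutator (gen Alpha) (gen Beta) - scalar (\<omega> / 2) * gen Alpha,
     commutator (gen Alpha) (gen Delta),
     commutator (gen Beta) (gen Delta) + scalar (\<omega> / 2) * gen Delta}"

definition heis_mat_comult ::
  "nat \<Rightarrow> nat \<Rightarrow> (heis_gen gen_word \<times> heis_gen gen_word) monoid_alg"
  where "heis_mat_comult i j = (\<Sum>k\<in>{1..3}. heis_mat i k \<boxtimes> heis_mat k j)"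

fun hq_comult_gen :: "heis_gen \<Rightarrow> (heis_gen gen_word \<times> heis_gen gen_word) monoid_alg" where
  "hq_comult_gen Alpha = heis_mat_comult 1 2"
| "hq_comult_gen Beta = heis_mat_comult 1 3"
| "hq_comult_gen Gamma = heis_mat_comult 2 2"
| "hq_comult_gen Delta = heis_mat_comult 2 3"
| "hq_comult_gen GammaInv = gen GammaInv \<boxtimes> gen GammaInv"

fun hq_counit_gen :: "heis_gen \<Rightarrow> complex" where
  "hq_counit_gen Gamma = 1"
| "hq_counit_gen GammaInv = 1"
| "hq_counit_gen _ = 0"

fun hq_antipode_gen :: "heis_gen \<Rightarrow> heis_gen free_alg" where
  "hq_antipode_gen Alpha = - gen GammaInv * gen Alpha"
| "hq_antipode_gen Beta = - gen Beta + gen GammaInv * gen Alpha * gen Delta"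
| "hq_antipode_gen Gamma = gen GammaInv"
| "hq_antipode_gen Delta = - gen GammaInv * gen Delta"
| "hq_antipode_gen GammaInv = gen Gamma"

definition hq_hopf :: "complex \<Rightarrow> heis_gen gen_word hopf_str"
  where "hq_hopf \<omega> =
    \<lparr>comult = descend (\<lambda>x. cls (tensor_rels (hq_rels \<omega>) (hq_rels \<omega>)) (hom_ext scalar hq_comult_gen x)),
     counit = descend (hom_ext id hq_counit_gen),
     antipode = descend (\<lambda>x. cls (hq_rels \<omega>) (antihom_ext scalar hq_antipode_gen x))\<rparr>"

definition bh_rels :: "complex \<Rightarrow> heis_gen free_alg set"
  where "bh_rels \<omega> = gamma_rels \<union>
    {commutator (gen Alpha) (gen Beta) - scalar \<omega> * gen Alpha,
     commutator (gen Alpha) (gen Delta) - scalar \<omega> * (gen Gamma - 1),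
     commutator (gen Beta) (gen Delta) - scalar \<omega> * gen Delta}"


section \<open>The pairing and the coadjoint action\<close>

definition mat_unit :: "nat \<Rightarrow> nat \<Rightarrow> nat \<Rightarrow> nat \<Rightarrow> complex"
  where "mat_unit a b i j = (if i = a \<and> j = b then 1 else 0)"

definition heis_pairing ::
  "complex \<Rightarrow> (uq_gen free_alg set \<Rightarrow> heis_gen free_alg set \<Rightarrow> complex) \<Rightarrow> bool"
  where "heis_pairing \<omega> p \<longleftrightarrow>
    hopf_pairing (uq_rels \<omega>) (uq_hopf \<omega>) (hq_rels \<omega>) (hq_hopf \<omega>) p \<and>
    (let U = cls (uq_rels \<omega>); t = (\<lambda>i j. cls (hq_rels \<omega>) (heis_mat i j)) in
      \<forall>i\<in>{1..3}. \<forall>j\<in>{1..3}.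
        p (U (gen QA)) (t i j) = mat_unit 1 2 i j \<and>
        p (U (gen QAd)) (t i j) = mat_unit 2 3 i j \<and>
        p (U (gen QH)) (t i j) = mat_unit 1 3 i j \<and>
        p (U (gen QN)) (t i j) = mat_unit 2 2 i j \<and>
        (\<forall>k. p (U (exp_H k)) (t i j) =
          (if i = j then 1 else 0) + of_int k * \<omega> / 4 * mat_unit 1 3 i j))"

definition coadjoint ::
  "complex \<Rightarrow> (uq_gen free_alg set \<Rightarrow> heis_gen free_alg set \<Rightarrow> complex) \<Rightarrow>
   uq_gen free_alg set \<Rightarrow> nat \<Rightarrow> nat \<Rightarrow> heis_gen free_alg set"
  where "coadjoint \<omega> p X i j =
    (let H = quot_alg (hq_rels \<omega>); B = quot_alg (bh_rels \<omega>);
         t = (\<lambda>i j. cls (hq_rels \<omega>) (heis_mat i j));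
         u = (\<lambda>i j. cls (bh_rels \<omega>) (heis_mat i j)) in
      \<Oplus>\<^bsub>B\<^esub>k\<in>{1..3}. \<Oplus>\<^bsub>B\<^esub>l\<in>{1..3}.
        p X (antipode (hq_hopf \<omega>) (t i k) \<otimes>\<^bsub>H\<^esub> t l j) \<odot>\<^bsub>B\<^esub> u k l)"

section \<open>The maps obtained by descent are well defined\<close>

text \<open>
  The results that matter are \<open>quot_alg_simps\<close>, \<open>bilin_ext_tensor\<close>, \<open>uq_hopf_cls\<close> and \<open>hq_hopf_cls\<close>:
  the comultiplications, counits and antipodes given on generators respect the defining relations,
  so that \<open>descend\<close> is applied only to maps that are constant on cosets.
\<close>

lemma ring_monoid_alg: "ring (monoid_alg_ring :: ('m::monoid_add) monoid_alg ring)"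
proof -
  have "abelian_group (monoid_alg_ring :: 'm monoid_alg ring)"
    by (rule abelian_groupI)
      (auto simp: monoid_alg_ring_def add.assoc intro: exI[of _ "- _"] exI ab_left_minus)
  then show ?thesis
    by (rule ringI) (auto intro!: monoidI simp: monoid_alg_ring_def mult.assoc ring_distribs)
qed

lemma ideal_rel_ideal: "ideal (rel_ideal R) monoid_alg_ring"
  unfolding rel_ideal_def
  by (rule ring.genideal_ideal[OF ring_monoid_alg]) (simp add: monoid_alg_ring_def)

lemma rel_ideal_gen: "r \<in> R \<Longrightarrow> r \<in> rel_ideal R"
  using ring.genideal_self[OF ring_monoid_alg, of R]
  by (auto simp: rel_ideal_def monoid_alg_ring_def)

lemma rel_ideal_add: "x \<in> rel_ideal R \<Longrightarrow> y \<in> rel_ideal R \<Longrightarrow> x + y \<in> rel_ideal R"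
  using additive_subgroup.a_closed[OF ideal.axioms(1)[OF ideal_rel_ideal]]
  by (fastforce simp: monoid_alg_ring_def)

lemma rel_ideal_zero: "0 \<in> rel_ideal R"
  using additive_subgroup.zero_closed[OF ideal.axioms(1)[OF ideal_rel_ideal]]
  by (fastforce simp: monoid_alg_ring_def)

lemma rel_ideal_left: "x \<in> rel_ideal R \<Longrightarrow> a * x \<in> rel_ideal R"
  using ideal.I_l_closed[OF ideal_rel_ideal, of x R a] by (simp add: monoid_alg_ring_def)

lemma rel_ideal_right: "x \<in> rel_ideal R \<Longrightarrow> x * a \<in> rel_ideal R"
  using ideal.I_r_closed[OF ideal_rel_ideal, of x R a] by (simp add: monoid_alg_ring_def)

lemma rel_ideal_uminus: "x \<in> rel_ideal R \<Longrightarrow> - x \<in> rel_ideal R"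
  using rel_ideal_left[of x R "- 1"] by simp

lemma rel_ideal_diff: "x \<in> rel_ideal R \<Longrightarrow> y \<in> rel_ideal R \<Longrightarrow> x - y \<in> rel_ideal R"
  using rel_ideal_add[of x R "- y"] rel_ideal_uminus[of y R] by simp

lemma rel_ideal_sum: "(\<And>i. i \<in> A \<Longrightarrow> f i \<in> rel_ideal R) \<Longrightarrow> sum f A \<in> rel_ideal R"
  by (induction A rule: infinite_finite_induct) (auto intro: rel_ideal_add rel_ideal_zero)

lemmas rel_ideal_intros = rel_ideal_add rel_ideal_zero rel_ideal_left rel_ideal_right
  rel_ideal_uminus rel_ideal_diff

lemma rel_ideal_induct [consumes 1, case_names gen zero add left right]:
  assumes "x \<in> rel_ideal R"
    and "\<And>r. r \<in> R \<Longrightarrow> P r" "P 0" "\<And>x y. P x \<Longrightarrow> P y \<Longrightarrow> P (x + y)"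
    and "\<And>a x. P x \<Longrightarrow> P (a * x)" "\<And>a x. P x \<Longrightarrow> P (x * a)"
  shows "P x"
proof -
  have "ideal {x. P x} monoid_alg_ring"
  proof (rule idealI[OF ring_monoid_alg])
    show "subgroup {x. P x} (add_monoid monoid_alg_ring)"
    proof (rule group.subgroupI)
      show "Group.group (add_monoid (monoid_alg_ring :: 'a monoid_alg ring))"
        using abelian_group.a_group[OF ring.is_abelian_group[OF ring_monoid_alg]] .
      show "inv\<^bsub>add_monoid monoid_alg_ring\<^esub> a \<in> {x. P x}" if "a \<in> {x. P x}" for a
      proof -
        interpret r: ring "monoid_alg_ring :: 'a monoid_alg ring" by (rule ring_monoid_alg)
        have "\<ominus>\<^bsub>monoid_alg_ring\<^esub> a = - a"
          by (rule r.minus_equality) (simp_all add: monoid_alg_ring_def)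
        moreover have "P (- a)" using assms(5)[of a "- 1"] that by simp
        ultimately show ?thesis by (simp add: a_inv_def)
      qed
    qed (use assms in \<open>auto simp: monoid_alg_ring_def\<close>)
  qed (use assms in \<open>auto simp: monoid_alg_ring_def\<close>)
  then have "rel_ideal R \<subseteq> {x. P x}"
    unfolding rel_ideal_def
    by (rule ring.genideal_minimal[OF ring_monoid_alg]) (use assms(2) in auto)
  then show ?thesis using assms(1) by auto
qed

lemma mem_cls: "y \<in> cls R x \<longleftrightarrow> y - x \<in> rel_ideal R"
proof -
  have "y \<in> cls R x \<longleftrightarrow> (\<exists>h\<in>rel_ideal R. y = h + x)"
    by (auto simp: cls_def a_r_coset_def r_coset_def monoid_alg_ring_def)
  also have "\<dots> \<longleftrightarrow> y - x \<in> rel_ideal R"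
    by (auto intro: bexI[of _ "y - x"])
  finally show ?thesis .
qed

lemma cls_eq_iff: "cls R x = cls R y \<longleftrightarrow> x - y \<in> rel_ideal R"
proof
  assume "cls R x = cls R y"
  then show "x - y \<in> rel_ideal R"
    using mem_cls[of x R x] by (simp add: mem_cls rel_ideal_zero)
next
  assume *: "x - y \<in> rel_ideal R"
  have "z - x \<in> rel_ideal R \<longleftrightarrow> z - y \<in> rel_ideal R" for z
    using rel_ideal_add[OF _ *, of "z - x"] rel_ideal_diff[OF _ *, of "z - y"] by auto
  then show "cls R x = cls R y"
    by (auto simp: mem_cls set_eq_iff)
qed

lemma descend_cls:
  assumes "\<And>y. y - x \<in> rel_ideal R \<Longrightarrow> f y = f x"
  shows "descend f (cls R x) = f x"
proof -
  have "f ` cls R x = {f x}"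
  proof (intro equalityI subsetI)
    fix z assume "z \<in> {f x}"
    moreover have "x \<in> cls R x" by (simp add: mem_cls rel_ideal_zero)
    ultimately show "z \<in> f ` cls R x" by blast
  next
    fix z assume "z \<in> f ` cls R x"
    then show "z \<in> {f x}" using assms by (auto simp: mem_cls)
  qed
  then show ?thesis by (simp add: descend_def)
qed

lemma quot_alg_simps:
  "carrier (quot_alg R) = range (cls R)"
  "cls R x \<oplus>\<^bsub>quot_alg R\<^esub> cls R y = cls R (x + y)"
  "cls R x \<otimes>\<^bsub>quot_alg R\<^esub> cls R y = cls R (x * y)"
  "c \<odot>\<^bsub>quot_alg R\<^esub> cls R x = cls R (scalar c * x)"
  "\<zero>\<^bsub>quot_alg R\<^esub> = cls R 0"
  "\<one>\<^bsub>quot_alg R\<^esub> = cls R 1"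
proof -
  interpret ideal "rel_ideal R" "monoid_alg_ring" by (rule ideal_rel_ideal)
  note d = quot_alg_def Let_def ring.defs module.defs FactRing_def
  have m: "rcoset_mult monoid_alg_ring (rel_ideal R) (cls R x) (cls R y) = cls R (x * y)" for x y
    using rcoset_mult_add[of x y] by (simp add: cls_def monoid_alg_ring_def)
  show "carrier (quot_alg R) = range (cls R)"
    by (auto simp: d A_RCOSETS_def RCOSETS_def cls_def a_r_coset_def monoid_alg_ring_def)
  show "cls R x \<oplus>\<^bsub>quot_alg R\<^esub> cls R y = cls R (x + y)"
    using a_rcos_sum[of x y] by (simp add: d cls_def monoid_alg_ring_def)
  show "cls R x \<otimes>\<^bsub>quot_alg R\<^esub> cls R y = cls R (x * y)"
    by (simp add: d m)
  show "c \<odot>\<^bsub>quot_alg R\<^esub> cls R x = cls R (scalar c * x)"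
    by (simp add: d m)
  show "\<zero>\<^bsub>quot_alg R\<^esub> = cls R 0"
    by (auto simp: d set_eq_iff mem_cls)
  show "\<one>\<^bsub>quot_alg R\<^esub> = cls R 1"
    by (simp add: d cls_def) (simp add: monoid_alg_ring_def)
qed

lemma ring_quot_alg: "ring (quot_alg R)"
proof -
  interpret ideal "rel_ideal R" "monoid_alg_ring" by (rule ideal_rel_ideal)
  interpret q: ring "monoid_alg_ring Quot rel_ideal R" by (rule quotient_is_ring)
  have "abelian_group (quot_alg R)"
  proof (rule abelian_groupI)
    fix x assume "x \<in> carrier (quot_alg R)"
    then obtain a where "x = cls R a" by (auto simp: quot_alg_simps)
    then show "\<exists>y\<in>carrier (quot_alg R). y \<oplus>\<^bsub>quot_alg R\<^esub> x = \<zero>\<^bsub>quot_alg R\<^esub>"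
      by (auto intro: exI[of _ "- a"] simp: quot_alg_simps)
  qed (auto simp: quot_alg_simps add_ac)
  then show ?thesis
    by (rule ringI) (auto intro!: monoidI simp: quot_alg_simps mult.assoc ring_distribs)
qed


lemma scalar_simps:
  "scalar (a + b) = scalar a + scalar b" "scalar (a * b) = scalar a * scalar b"
  "scalar 0 = 0" "scalar 1 = 1" "scalar (- a) = - scalar a" "scalar (a - b) = scalar a - scalar b"
  by (simp_all add: scalar_def single_add mult_single single_uminus single_diff)

lemma monoid_alg_induct [case_names zero basis add]:
  assumes "P 0" "\<And>c m. P (scalar c * basis m)" "\<And>x y. P x \<Longrightarrow> P y \<Longrightarrow> P (x + y)"
  shows "P x"
proof -
  have "x = (\<Sum>m\<in>Poly_Mapping.keys x. Poly_Mapping.single m (Poly_Mapping.lookup x m))"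
    by (rule poly_mapping_eqI)
      (auto simp: lookup_sum lookup_single when_def sum.delta in_keys_iff)
  moreover have "P (\<Sum>m\<in>A. Poly_Mapping.single m (Poly_Mapping.lookup x m))" if "finite A" for A
    using that assms(2)[of "Poly_Mapping.lookup x _"]
    by induction (auto intro: assms simp: scalar_def basis_def mult_single)
  ultimately show ?thesis by (metis finite_keys)
qed

lemma scalar_central: "x * scalar c = scalar c * x"
  by (induction x rule: monoid_alg_induct)
    (simp_all add: scalar_def basis_def mult_single algebra_simps)

lemma lookup_zero_keys: "finite A \<Longrightarrow> Poly_Mapping.keys x \<subseteq> A \<Longrightarrow> (\<And>w. h w 0 = 0) \<Longrightarrow>
   (\<Sum>w\<in>Poly_Mapping.keys x. h w (Poly_Mapping.lookup x w)) = (\<Sum>w\<in>A. h w (Poly_Mapping.lookup x w))"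
  by (rule sum.mono_neutral_left) (auto simp: in_keys_iff)

lemma keys_sum_add:
  fixes h :: "'m \<Rightarrow> complex \<Rightarrow> 'b::comm_monoid_add" and x y :: "'m \<Rightarrow>\<^sub>0 complex"
  assumes "\<And>w. h w 0 = 0" "\<And>w a b. h w (a + b) = h w a + h w b"
  shows "(\<Sum>w\<in>Poly_Mapping.keys (x + y). h w (Poly_Mapping.lookup (x + y) w)) =
    (\<Sum>w\<in>Poly_Mapping.keys x. h w (Poly_Mapping.lookup x w)) +
    (\<Sum>w\<in>Poly_Mapping.keys y. h w (Poly_Mapping.lookup y w))"
proof -
  let ?A = "Poly_Mapping.keys x \<union> Poly_Mapping.keys y"
  show ?thesis
    using lookup_zero_keys[of ?A "x + y" h] lookup_zero_keys[of ?A x h] lookup_zero_keys[of ?A y h]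
      keys_add[of x y]
    by (simp add: assms lookup_add sum.distrib)
qed

locale scalar_embedding =
  fixes \<iota> :: "complex \<Rightarrow> 'a::ring_1"
  assumes \<iota>: "\<iota> 0 = 0" "\<iota> 1 = 1" "\<iota> (a + b) = \<iota> a + \<iota> b" "\<iota> (a * b) = \<iota> a * \<iota> b"
    and \<iota>_central: "z * \<iota> a = \<iota> a * z"
begin

lemma hom_ext_add: "hom_ext \<iota> f (x + y) = hom_ext \<iota> f x + hom_ext \<iota> f y"
  unfolding hom_ext_def by (rule keys_sum_add) (simp_all add: \<iota> ring_distribs)

lemma antihom_ext_add: "antihom_ext \<iota> f (x + y) = antihom_ext \<iota> f x + antihom_ext \<iota> f y"
  unfolding antihom_ext_def by (rule keys_sum_add) (simp_all add: \<iota> ring_distribs)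

lemma hom_ext_zero: "hom_ext \<iota> f 0 = 0"
  by (simp add: hom_ext_def)

lemma antihom_ext_zero: "antihom_ext \<iota> f 0 = 0"
  by (simp add: antihom_ext_def)

lemma hom_ext_monom: "hom_ext \<iota> f (scalar c * basis w) = \<iota> c * prod_list (map f (letters w))"
  by (simp add: hom_ext_def scalar_def basis_def mult_single \<iota>)

lemma antihom_ext_monom:
  "antihom_ext \<iota> f (scalar c * basis w) = \<iota> c * prod_list (map f (rev (letters w)))"
  by (simp add: antihom_ext_def scalar_def basis_def mult_single \<iota>)

lemma monom_mult: "(scalar c * basis v) * (scalar d * basis w) = scalar (c * d) * basis (v + w)"
  by (simp add: scalar_def basis_def mult_single)

lemma hom_ext_mult: "hom_ext \<iota> f (x * y) = hom_ext \<iota> f x * hom_ext \<iota> f y"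
proof (induction x rule: monoid_alg_induct)
  case (basis c m)
  show ?case
  proof (induction y rule: monoid_alg_induct)
    case (basis d n)
    have "\<iota> c * \<iota> d * (prod_list (map f (letters m)) * prod_list (map f (letters n))) =
      \<iota> c * (prod_list (map f (letters m)) * \<iota> d) * prod_list (map f (letters n))"
      by (simp only: \<iota>_central[of "prod_list (map f (letters m))" d] mult.assoc)
    then show ?case
      by (simp only: monom_mult hom_ext_monom \<iota>) (simp add: plus_gen_word_def mult.assoc)
  qed (simp_all add: hom_ext_add hom_ext_zero ring_distribs)
qed (simp_all add: hom_ext_add hom_ext_zero ring_distribs)

lemma antihom_ext_mult: "antihom_ext \<iota> f (x * y) = antihom_ext \<iota> f y * antihom_ext \<iota> f x"
proof (induction x rule: monoid_alg_induct)
  case (basis c m)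
  show ?case
  proof (induction y rule: monoid_alg_induct)
    case (basis d n)
    have "\<iota> d * \<iota> c * (prod_list (map f (rev (letters n))) * prod_list (map f (rev (letters m)))) =
      \<iota> d * (prod_list (map f (rev (letters n))) * \<iota> c) * prod_list (map f (rev (letters m)))"
      by (simp only: \<iota>_central[of "prod_list (map f (rev (letters n)))" c] mult.assoc)
    then show ?case
      by (simp only: monom_mult antihom_ext_monom \<iota> mult.commute[of c d])
        (simp add: plus_gen_word_def mult.assoc)
  qed (simp_all add: antihom_ext_add antihom_ext_zero ring_distribs)
qed (simp_all add: antihom_ext_add antihom_ext_zero ring_distribs)

lemma hom_ext_scalar: "hom_ext \<iota> f (scalar c) = \<iota> c"
  by (simp add: hom_ext_def scalar_def zero_gen_word_def \<iota>)

lemma antihom_ext_scalar: "antihom_ext \<iota> f (scalar c) = \<iota> c"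
  by (simp add: antihom_ext_def scalar_def zero_gen_word_def \<iota>)

lemma hom_ext_gen: "hom_ext \<iota> f (gen x) = f x"
  using hom_ext_monom[of f 1 "Word [x]"] by (simp add: scalar_simps \<iota> gen_def)

lemma antihom_ext_gen: "antihom_ext \<iota> f (gen x) = f x"
  using antihom_ext_monom[of f 1 "Word [x]"] by (simp add: scalar_simps \<iota> gen_def)

lemma hom_ext_one: "hom_ext \<iota> f 1 = 1"
  using hom_ext_scalar[of f 1] by (simp add: scalar_simps \<iota>)

lemma antihom_ext_one: "antihom_ext \<iota> f 1 = 1"
  using antihom_ext_scalar[of f 1] by (simp add: scalar_simps \<iota>)

lemma hom_ext_uminus: "hom_ext \<iota> f (- x) = - hom_ext \<iota> f x"
  using hom_ext_add[of f x "- x"] by (simp add: hom_ext_zero eq_neg_iff_add_eq_0 add.commute)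

lemma antihom_ext_uminus: "antihom_ext \<iota> f (- x) = - antihom_ext \<iota> f x"
  using antihom_ext_add[of f x "- x"] by (simp add: antihom_ext_zero eq_neg_iff_add_eq_0 add.commute)

lemma hom_ext_diff: "hom_ext \<iota> f (x - y) = hom_ext \<iota> f x - hom_ext \<iota> f y"
  using hom_ext_add[of f x "- y"] by (simp add: hom_ext_uminus)

lemma antihom_ext_diff: "antihom_ext \<iota> f (x - y) = antihom_ext \<iota> f x - antihom_ext \<iota> f y"
  using antihom_ext_add[of f x "- y"] by (simp add: antihom_ext_uminus)

lemma hom_ext_power: "hom_ext \<iota> f (x ^ n) = hom_ext \<iota> f x ^ n"
  by (induction n) (simp_all add: hom_ext_one hom_ext_mult)

lemma antihom_ext_power: "antihom_ext \<iota> f (x ^ n) = antihom_ext \<iota> f x ^ n"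
  by (induction n) (simp_all add: antihom_ext_one antihom_ext_mult power_commutes)

lemmas hom_ext_simps = hom_ext_add hom_ext_zero hom_ext_one hom_ext_mult hom_ext_scalar
  hom_ext_gen hom_ext_uminus hom_ext_diff hom_ext_power

lemmas antihom_ext_simps = antihom_ext_add antihom_ext_zero antihom_ext_one antihom_ext_mult
  antihom_ext_scalar antihom_ext_gen antihom_ext_uminus antihom_ext_diff antihom_ext_power

end

interpretation scalar: scalar_embedding scalar
  by standard (simp_all add: scalar_simps, rule scalar_central)

interpretation cnt: scalar_embedding "id :: complex \<Rightarrow> complex"
  by standard (simp_all add: mult.commute)

lemma tensor_zero: "0 \<boxtimes> y = 0" "x \<boxtimes> 0 = 0"
  by (simp_all add: tensor_def)

lemma tensor_add_left: "(x + x') \<boxtimes> y = x \<boxtimes> y + x' \<boxtimes> y"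
  unfolding tensor_def
  by (rule keys_sum_add) (simp_all add: single_add ring_distribs sum.distrib)

lemma tensor_add_right: "x \<boxtimes> (y + y') = x \<boxtimes> y + x \<boxtimes> y'"
  unfolding tensor_def sum.distrib[symmetric]
  by (intro sum.cong refl keys_sum_add) (simp_all add: single_add ring_distribs)

lemma tensor_monom:
  "(scalar c * basis v) \<boxtimes> (scalar d * basis w) = scalar (c * d) * basis (v, w)"
  by (simp add: tensor_def scalar_def basis_def mult_single zero_prod_def)

lemma basis_mult: "(scalar c * basis v) * (scalar d * basis w) = scalar (c * d) * basis (v + w)"
  by (simp add: scalar_def basis_def mult_single)

lemma tensor_mult: "(x \<boxtimes> y) * (x' \<boxtimes> y') = (x * x') \<boxtimes> (y * y')"
proof (induction x rule: monoid_alg_induct)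
  case (basis c m)
  show ?case
  proof (induction y rule: monoid_alg_induct)
    case (basis c' m')
    show ?case
    proof (induction x' rule: monoid_alg_induct)
      case (basis d n)
      show ?case
      proof (induction y' rule: monoid_alg_induct)
        case (basis d' n')
        show ?case
          by (simp only: basis_mult tensor_monom plus_prod_def fst_conv snd_conv) (simp add: mult_ac)
      qed (simp_all add: tensor_add_left tensor_add_right tensor_zero ring_distribs)
    qed (simp_all add: tensor_add_left tensor_add_right tensor_zero ring_distribs)
  qed (simp_all add: tensor_add_left tensor_add_right tensor_zero ring_distribs)
qed (simp_all add: tensor_add_left tensor_add_right tensor_zero ring_distribs)

lemma tensor_uminus_left: "(- x) \<boxtimes> y = - (x \<boxtimes> y)"
  using tensor_add_left[of x "- x" y] by (simp add: tensor_zero eq_neg_iff_add_eq_0 add.commute)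

lemma tensor_uminus_right: "x \<boxtimes> (- y) = - (x \<boxtimes> y)"
  using tensor_add_right[of x y "- y"] by (simp add: tensor_zero eq_neg_iff_add_eq_0 add.commute)

lemma tensor_diff_left: "(x - x') \<boxtimes> y = x \<boxtimes> y - x' \<boxtimes> y"
  using tensor_add_left[of x "- x'" y] by (simp add: tensor_uminus_left)

lemma tensor_diff_right: "x \<boxtimes> (y - y') = x \<boxtimes> y - x \<boxtimes> y'"
  using tensor_add_right[of x y "- y'"] by (simp add: tensor_uminus_right)

lemma basis_zero: "basis 0 = 1"
  by (simp add: basis_def)

lemma tensor_one: "1 \<boxtimes> 1 = 1"
  using tensor_monom[of 1 0 1 0] by (simp add: scalar_simps basis_zero zero_prod_def[symmetric])

lemma tensor_scalar_one: "scalar c \<boxtimes> 1 = scalar c"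
  using tensor_monom[of c 0 1 0] by (simp add: scalar_simps basis_zero zero_prod_def[symmetric])

lemma tensor_one_scalar: "1 \<boxtimes> scalar c = scalar c"
  using tensor_monom[of 1 0 c 0] by (simp add: scalar_simps basis_zero zero_prod_def[symmetric])

lemma tensor_scalar_left: "(scalar c * x) \<boxtimes> y = scalar c * (x \<boxtimes> y)"
  using tensor_mult[of "scalar c" 1 x y] by (simp add: tensor_scalar_one)

lemma tensor_scalar_right: "x \<boxtimes> (scalar c * y) = scalar c * (x \<boxtimes> y)"
  using tensor_mult[of 1 "scalar c" x y] by (simp add: tensor_one_scalar)

lemmas tensor_simps = tensor_zero tensor_add_left tensor_add_right tensor_uminus_left
  tensor_uminus_right tensor_diff_left tensor_diff_right tensor_scalar_left tensor_scalar_right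
  tensor_mult tensor_one tensor_scalar_one tensor_one_scalar

lemma tensor_split: "x \<boxtimes> y = (x \<boxtimes> 1) * (1 \<boxtimes> y)"
  by (simp add: tensor_mult)

lemma tensor_ideal_left:
  assumes "x \<in> rel_ideal R" shows "x \<boxtimes> y \<in> rel_ideal (tensor_rels R R')"
proof -
  have "x \<boxtimes> 1 \<in> rel_ideal (tensor_rels R R')"
    using assms
  proof (induction rule: rel_ideal_induct)
    case (gen r)
    then show ?case by (intro rel_ideal_gen) (auto simp: tensor_rels_def)
  next
    case (left a x)
    then show ?case using rel_ideal_left[of "x \<boxtimes> 1" _ "a \<boxtimes> 1"] by (simp add: tensor_mult)
  next
    case (right a x)
    then show ?case using rel_ideal_right[of "x \<boxtimes> 1" _ "a \<boxtimes> 1"] by (simp add: tensor_mult)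
  qed (simp_all add: tensor_simps rel_ideal_intros)
  then show ?thesis by (subst tensor_split) (rule rel_ideal_right)
qed

lemma tensor_ideal_right:
  assumes "y \<in> rel_ideal R'" shows "x \<boxtimes> y \<in> rel_ideal (tensor_rels R R')"
proof -
  have "1 \<boxtimes> y \<in> rel_ideal (tensor_rels R R')"
    using assms
  proof (induction rule: rel_ideal_induct)
    case (gen r)
    then show ?case by (intro rel_ideal_gen) (auto simp: tensor_rels_def)
  next
    case (left a x)
    then show ?case using rel_ideal_left[of "1 \<boxtimes> x" _ "1 \<boxtimes> a"] by (simp add: tensor_mult)
  next
    case (right a x)
    then show ?case using rel_ideal_right[of "1 \<boxtimes> x" _ "1 \<boxtimes> a"] by (simp add: tensor_mult)
  qed (simp_all add: tensor_simps rel_ideal_intros)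
  then show ?thesis by (subst tensor_split) (rule rel_ideal_left)
qed

lemma bilin_ext_tensor:
  assumes b: "\<And>x y z. b (cls R (x + y)) (cls R' z) = b (cls R x) (cls R' z) + b (cls R y) (cls R' z)"
    "\<And>x y z. b (cls R z) (cls R' (x + y)) = b (cls R z) (cls R' x) + b (cls R z) (cls R' y)"
    "\<And>c x y. b (cls R (scalar c * x)) (cls R' y) = c * b (cls R x) (cls R' y)"
    "\<And>c x y. b (cls R x) (cls R' (scalar c * y)) = c * b (cls R x) (cls R' y)"
  defines "T \<equiv> bilin_ext R R' b \<circ> cls (tensor_rels R R')"
  shows "T (x \<boxtimes> y) = b (cls R x) (cls R' y)" "T (z + z') = T z + T z'"
    "T (scalar c * z) = c * T z"
proof -
  define B where "B = (\<lambda>z. \<Sum>(v, w)\<in>Poly_Mapping.keys z.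
    Poly_Mapping.lookup z (v, w) * b (cls R (basis v)) (cls R' (basis w)))"
  have Bdef: "B z = (\<Sum>i\<in>Poly_Mapping.keys z. Poly_Mapping.lookup z i *
     (case i of (v, w) \<Rightarrow> b (cls R (basis v)) (cls R' (basis w))))" for z
    unfolding B_def by (intro sum.cong) auto
  have Badd: "B (z + z') = B z + B z'" for z z'
    unfolding Bdef by (rule keys_sum_add) (simp_all add: ring_distribs)
  have B0: "B 0 = 0" by (simp add: B_def)
  have Bm: "B (scalar c * basis (v, w)) = c * b (cls R (basis v)) (cls R' (basis w))" for c v w
    by (simp add: B_def scalar_def basis_def[of "(v, w)"] mult_single)
  have b0: "b (cls R 0) (cls R' z) = 0" "b (cls R z') (cls R' 0) = 0" for z z'
    using b(1)[of 0 0 z] b(2)[of z' 0 0] by simp_all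
  have Bt: "B (x \<boxtimes> y) = b (cls R x) (cls R' y)" for x y
  proof (induction x rule: monoid_alg_induct)
    case (basis c m)
    show ?case
    proof (induction y rule: monoid_alg_induct)
      case (basis d n)
      then show ?case by (simp only: tensor_monom Bm b) (simp add: mult_ac)
    qed (simp_all add: Badd B0 b b0 tensor_simps)
  qed (simp_all add: Badd B0 b b0 tensor_simps)
  have Bsc: "B (scalar c * z) = c * B z" for c z
  proof (induction z rule: monoid_alg_induct)
    case (basis d m)
    then show ?case
      by (cases m) (simp only: mult.assoc[symmetric] scalar_simps(2)[symmetric] Bm)
  qed (simp_all add: Badd B0 ring_distribs)
  have Bminus: "B (- z) = - B z" for z
    using Badd[of z "- z"] B0 by (simp add: eq_neg_iff_add_eq_0 add.commute)
  have zero_left: "b (cls R r) y = 0" if "r \<in> rel_ideal R" "y \<in> range (cls R')" for r y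
    using that b0 cls_eq_iff[of R r 0] by auto
  have zero_right: "b y (cls R' r) = 0" if "r \<in> rel_ideal R'" "y \<in> range (cls R)" for r y
    using that b0 cls_eq_iff[of R' r 0] by auto
  have *: "\<forall>a a'. B (a * z * a') = 0" if "z \<in> rel_ideal (tensor_rels R R')" for z
    using that
  proof (induction rule: rel_ideal_induct)
    case (gen r)
    have "B (a * r * a') = 0" for a a'
    proof (induction a rule: monoid_alg_induct)
      case (basis c m)
      show ?case
      proof (induction a' rule: monoid_alg_induct)
        case (basis d n)
        obtain m1 m2 n1 n2 where mn: "m = (m1, m2)" "n = (n1, n2)" by (cases m, cases n)
        have mb: "scalar c * basis m = (scalar c * basis m1) \<boxtimes> basis m2"
          "scalar d * basis n = (scalar d * basis n1) \<boxtimes> basis n2"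
          using tensor_monom[of c m1 1 m2] tensor_monom[of d n1 1 n2] by (simp_all add: mn scalar_simps)
        from gen show ?case unfolding mb tensor_rels_def
          by (auto simp: tensor_mult Bt zero_left zero_right rel_ideal_gen rel_ideal_left
              rel_ideal_right)
      qed (simp_all add: Badd B0 ring_distribs)
    qed (simp_all add: Badd B0 ring_distribs)
    then show ?case by blast
  next
    case (left a x)
    then show ?case by (metis mult.assoc)
  next
    case (right a x)
    then show ?case by (metis mult.assoc)
  qed (simp_all add: Badd B0 ring_distribs)
  have "B y = B z" if "y - z \<in> rel_ideal (tensor_rels R R')" for y z
    using *[OF that, rule_format, of 1 1] Badd[of "y - z" z] by simp
  then have T: "T z = B z" for z
    unfolding T_def bilin_ext_def B_def[symmetric] comp_def by (rule descend_cls) 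
  show "T (x \<boxtimes> y) = b (cls R x) (cls R' y)" "T (z + z') = T z + T z'"
    "T (scalar c * z) = c * T z"
    by (simp_all add: T Bt Badd Bsc)
qed


lemma exp_H_simps: "exp_H 1 = gen Qg" "exp_H (- 1) = gen Qginv"
  "exp_H 2 = gen Qg * gen Qg" "exp_H (- 2) = gen Qginv * gen Qginv" "exp_H 0 = 1"
  by (simp_all add: exp_H_def power2_eq_square)

lemma uq_central_inv: "commutator (gen Qginv) (gen x) \<in> rel_ideal (uq_rels \<omega>)"
proof -
  let ?K = "gen Qginv" and ?G = "gen Qg" and ?x = "gen x"
  have "commutator ?K ?x = ?K * commutator ?x ?G * ?K - ?K * ?x * (?G * ?K - 1) + (?K * ?G - 1) * ?x * ?K"
    by (simp add: commutator_def algebra_simps)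
  moreover have "commutator ?x ?G = - commutator ?G ?x" by (simp add: commutator_def)
  moreover have "?G * ?K - 1 \<in> rel_ideal (uq_rels \<omega>)" "?K * ?G - 1 \<in> rel_ideal (uq_rels \<omega>)"
    "commutator ?G ?x \<in> rel_ideal (uq_rels \<omega>)"
    by (auto intro!: rel_ideal_gen simp: uq_rels_def)
  ultimately show ?thesis
    by (simp add: rel_ideal_intros)
qed

lemma uq_comult_rels:
  assumes "r \<in> uq_rels \<omega>"
  shows "hom_ext scalar uq_comult_gen r \<in> rel_ideal (tensor_rels (uq_rels \<omega>) (uq_rels \<omega>))"
    (is "_ \<in> ?J")
proof -
  let ?A = "gen QA" and ?B = "gen QAd" and ?N = "gen QN" and ?G = "gen Qg" and ?K = "gen Qginv"
    and ?H = "gen QH" and ?I = "rel_ideal (uq_rels \<omega>)" and ?s = "scalar (1 / \<omega>) :: uq_gen free_alg"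
  note simps = commutator_def scalar.hom_ext_simps tensor_simps exp_H_simps algebra_simps
  have G: "?G * gen x - gen x * ?G \<in> ?I" and H: "?H * gen x - gen x * ?H \<in> ?I" for x
    by (auto intro!: rel_ideal_gen simp: uq_rels_def commutator_def)
  have K: "?K * gen x - gen x * ?K \<in> ?I" for x
    using uq_central_inv[of x] by (simp add: commutator_def)
  have r: "?A * ?B - ?B * ?A - ?s * (?G * ?G - ?K * ?K) \<in> ?I" "?N * ?A - ?A * ?N + ?A \<in> ?I"
    "?N * ?B - ?B * ?N - ?B \<in> ?I" "?G * ?K - 1 \<in> ?I" "?K * ?G - 1 \<in> ?I"
    by (auto intro!: rel_ideal_gen simp: uq_rels_def commutator_def exp_H_simps)
  note J = rel_ideal_add rel_ideal_zero rel_ideal_diff tensor_ideal_left tensor_ideal_right G H K r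
  have Gx: "hom_ext scalar uq_comult_gen (commutator ?G (gen x)) \<in> ?J" for x
  proof -
    have "hom_ext scalar uq_comult_gen (commutator ?G (gen x)) =
      (case x of
         QA \<Rightarrow> (?G * ?K - ?K * ?G) \<boxtimes> (?G * ?A) + (?K * ?G) \<boxtimes> (?G * ?A - ?A * ?G) + (?G * ?A - ?A * ?G) \<boxtimes> (?G * ?G)
       | QAd \<Rightarrow> (?G * ?K - ?K * ?G) \<boxtimes> (?G * ?B) + (?K * ?G) \<boxtimes> (?G * ?B - ?B * ?G) + (?G * ?B - ?B * ?G) \<boxtimes> (?G * ?G)
       | QN \<Rightarrow> (?G * ?N - ?N * ?G) \<boxtimes> ?G + ?G \<boxtimes> (?G * ?N - ?N * ?G)
       | QH \<Rightarrow> (?G * ?H - ?H * ?G) \<boxtimes> ?G + ?G \<boxtimes> (?G * ?H - ?H * ?G)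
       | Qg \<Rightarrow> 0
       | Qginv \<Rightarrow> (?G * ?K - ?K * ?G) \<boxtimes> (?G * ?K) + (?K * ?G) \<boxtimes> (?G * ?K - ?K * ?G))"
      by (cases x) (simp_all add: simps)
    also have "\<dots> \<in> ?J" by (cases x) (simp_all add: J)
    finally show ?thesis .
  qed
  have Hx: "hom_ext scalar uq_comult_gen (commutator ?H (gen x)) \<in> ?J" for x
  proof -
    have "hom_ext scalar uq_comult_gen (commutator ?H (gen x)) =
      (case x of
         QA \<Rightarrow> (?H * ?K - ?K * ?H) \<boxtimes> ?A + (?H * ?A - ?A * ?H) \<boxtimes> ?G + ?K \<boxtimes> (?H * ?A - ?A * ?H) + ?A \<boxtimes> (?H * ?G - ?G * ?H)
       | QAd \<Rightarrow> (?H * ?K - ?K * ?H) \<boxtimes> ?B + (?H * ?B - ?B * ?H) \<boxtimes> ?G + ?K \<boxtimes> (?H * ?B - ?B * ?H) + ?B \<boxtimes> (?H * ?G - ?G * ?H)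
       | QN \<Rightarrow> (?H * ?N - ?N * ?H) \<boxtimes> 1 + 1 \<boxtimes> (?H * ?N - ?N * ?H)
       | QH \<Rightarrow> 0
       | Qg \<Rightarrow> (?H * ?G - ?G * ?H) \<boxtimes> ?G + ?G \<boxtimes> (?H * ?G - ?G * ?H)
       | Qginv \<Rightarrow> (?H * ?K - ?K * ?H) \<boxtimes> ?K + ?K \<boxtimes> (?H * ?K - ?K * ?H))"
      by (cases x) (simp_all add: simps)
    also have "\<dots> \<in> ?J" by (cases x) (simp_all add: J)
    finally show ?thesis .
  qed
  have AB: "hom_ext scalar uq_comult_gen (commutator ?A ?B - scalar (1 / \<omega>) * (exp_H 2 - exp_H (- 2))) =
    (?K * ?K) \<boxtimes> (?A * ?B - ?B * ?A - ?s * (?G * ?G - ?K * ?K))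
    + (?A * ?B - ?B * ?A - ?s * (?G * ?G - ?K * ?K)) \<boxtimes> (?G * ?G)
    + (?K * ?B - ?B * ?K) \<boxtimes> (?A * ?G) - (?B * ?K) \<boxtimes> (?G * ?A - ?A * ?G)
    - (?K * ?A - ?A * ?K) \<boxtimes> (?B * ?G) + (?A * ?K) \<boxtimes> (?G * ?B - ?B * ?G)"
    by (simp add: simps)
  have NA: "hom_ext scalar uq_comult_gen (commutator ?N ?A + ?A) =
     ?K \<boxtimes> (?N * ?A - ?A * ?N + ?A) + (?N * ?A - ?A * ?N + ?A) \<boxtimes> ?G - (?K * ?N - ?N * ?K) \<boxtimes> ?A - ?A \<boxtimes> (?G * ?N - ?N * ?G)"
    by (simp add: simps)
  have NB: "hom_ext scalar uq_comult_gen (commutator ?N ?B - ?B) =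
     ?K \<boxtimes> (?N * ?B - ?B * ?N - ?B) + (?N * ?B - ?B * ?N - ?B) \<boxtimes> ?G - (?K * ?N - ?N * ?K) \<boxtimes> ?B - ?B \<boxtimes> (?G * ?N - ?N * ?G)"
    by (simp add: simps)
  have GK: "hom_ext scalar uq_comult_gen (?G * ?K - 1) = (?G * ?K - 1) \<boxtimes> (?G * ?K) + 1 \<boxtimes> (?G * ?K - 1)"
    "hom_ext scalar uq_comult_gen (?K * ?G - 1) = (?K * ?G - 1) \<boxtimes> (?K * ?G) + 1 \<boxtimes> (?K * ?G - 1)"
    by (simp_all add: simps)
  have "hom_ext scalar uq_comult_gen (commutator ?A ?B - scalar (1 / \<omega>) * (exp_H 2 - exp_H (- 2))) \<in> ?J"
    "hom_ext scalar uq_comult_gen (commutator ?N ?A + ?A) \<in> ?J"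
    "hom_ext scalar uq_comult_gen (commutator ?N ?B - ?B) \<in> ?J"
    "hom_ext scalar uq_comult_gen (?G * ?K - 1) \<in> ?J" "hom_ext scalar uq_comult_gen (?K * ?G - 1) \<in> ?J"
    unfolding AB NA NB GK by (simp_all add: J del: minus_diff_eq)
  with assms Gx Hx show ?thesis
    by (subst (asm) uq_rels_def) (elim UnE insertE emptyE CollectE exE conjE, simp_all)
qed

lemma uq_counit_rels: "r \<in> uq_rels \<omega> \<Longrightarrow> hom_ext id uq_counit_gen r = 0"
  by (auto simp: uq_rels_def cnt.hom_ext_simps commutator_def exp_H_simps)

lemma uq_antipode_rels:
  assumes "r \<in> uq_rels \<omega>"
  shows "antihom_ext scalar uq_antipode_gen r \<in> rel_ideal (uq_rels \<omega>)"
    (is "_ \<in> ?I")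
proof -
  let ?A = "gen QA" and ?B = "gen QAd" and ?N = "gen QN" and ?G = "gen Qg" and ?K = "gen Qginv"
    and ?H = "gen QH" and ?s = "scalar (1 / \<omega>) :: uq_gen free_alg" and ?S = "antihom_ext scalar uq_antipode_gen"
  note simps = commutator_def scalar.antihom_ext_simps exp_H_simps
  have G: "?G * gen x - gen x * ?G \<in> ?I" and H: "?H * gen x - gen x * ?H \<in> ?I" for x
    by (auto intro!: rel_ideal_gen simp: uq_rels_def commutator_def)
  have K: "?K * gen x - gen x * ?K \<in> ?I" for x
    using uq_central_inv[of x] by (simp add: commutator_def)
  have r: "?A * ?B - ?B * ?A - ?s * (?G * ?G - ?K * ?K) \<in> ?I" "?N * ?A - ?A * ?N + ?A \<in> ?I"
    "?N * ?B - ?B * ?N - ?B \<in> ?I" "?G * ?K - 1 \<in> ?I" "?K * ?G - 1 \<in> ?I"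
    by (auto intro!: rel_ideal_gen simp: uq_rels_def commutator_def exp_H_simps)
  have Hx: "?S (commutator ?H (gen x)) \<in> ?I" for x
    using H[of x] rel_ideal_uminus[OF H[of x]] H[of Qg] H[of Qginv] rel_ideal_uminus[OF H[of Qg]] rel_ideal_uminus[OF H[of Qginv]]
    by (cases x) (simp_all add: simps)
  have Gx: "?S (commutator ?G (gen x)) \<in> ?I" for x
    using K[of x] rel_ideal_uminus[OF K[of x]] K[of Qg] rel_ideal_uminus[OF K[of Qg]]
    by (cases x) (simp_all add: simps rel_ideal_zero)
  have "?S (commutator ?A ?B - scalar (1 / \<omega>) * (exp_H 2 - exp_H (- 2))) =
      - (?A * ?B - ?B * ?A - ?s * (?G * ?G - ?K * ?K))"
    by (simp add: simps scalar_central[of _ "1 / \<omega>"]) (simp add: algebra_simps)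
  moreover have "?S (commutator ?N ?A + ?A) = - (?N * ?A - ?A * ?N + ?A)"
    "?S (commutator ?N ?B - ?B) = - (?N * ?B - ?B * ?N - ?B)"
    "?S (?G * ?K - 1) = ?G * ?K - 1" "?S (?K * ?G - 1) = ?K * ?G - 1"
    by (simp_all add: simps)
  ultimately have "?S (commutator ?A ?B - scalar (1 / \<omega>) * (exp_H 2 - exp_H (- 2))) \<in> ?I"
    "?S (commutator ?N ?A + ?A) \<in> ?I" "?S (commutator ?N ?B - ?B) \<in> ?I"
    "?S (?G * ?K - 1) \<in> ?I" "?S (?K * ?G - 1) \<in> ?I"
    using r by (simp_all only: rel_ideal_uminus)
  with assms Gx Hx show ?thesis
    by (subst (asm) uq_rels_def) (elim UnE insertE emptyE CollectE exE conjE, simp_all)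
qed

lemma idx3: "{1..3::nat} = {1, 2, 3}" by auto

lemma heis_mat_simps:
  "heis_mat (Suc 0) (Suc 0) = 1" "heis_mat (Suc 0) 2 = gen Alpha" "heis_mat (Suc 0) 3 = gen Beta"
  "heis_mat 2 (Suc 0) = 0" "heis_mat 2 2 = gen Gamma" "heis_mat 2 3 = gen Delta"
  "heis_mat 3 (Suc 0) = 0" "heis_mat 3 2 = 0" "heis_mat 3 3 = 1"
  by (simp_all add: heis_mat_def mat_of_def numeral_2_eq_2 numeral_3_eq_3)

lemma heis_comult_simps:
  "heis_mat_comult 1 2 = 1 \<boxtimes> gen Alpha + gen Alpha \<boxtimes> gen Gamma"
  "heis_mat_comult 1 3 = 1 \<boxtimes> gen Beta + gen Alpha \<boxtimes> gen Delta + gen Beta \<boxtimes> 1"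
  "heis_mat_comult 2 2 = gen Gamma \<boxtimes> gen Gamma"
  "heis_mat_comult 2 3 = gen Gamma \<boxtimes> gen Delta + gen Delta \<boxtimes> 1"
  unfolding heis_mat_comult_def idx3 by (simp_all add: heis_mat_simps tensor_zero add.assoc)

lemma hq_members:
  fixes \<omega>
  defines "I \<equiv> rel_ideal (hq_rels \<omega>)" and "s \<equiv> scalar (\<omega> / 2)"
  shows "gen Gamma * gen x - gen x * gen Gamma \<in> I"
    "gen GammaInv * gen x - gen x * gen GammaInv \<in> I"
    "gen Gamma * gen GammaInv - 1 \<in> I" "gen GammaInv * gen Gamma - 1 \<in> I"
    "gen Alpha * gen Beta - gen Beta * gen Alpha - s * gen Alpha \<in> I"
    "gen Alpha * gen Delta - gen Delta * gen Alpha \<in> I"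
    "gen Beta * gen Delta - gen Delta * gen Beta + s * gen Delta \<in> I"
proof -
  show G: "gen Gamma * gen x - gen x * gen Gamma \<in> I" 
    and GK: "gen Gamma * gen GammaInv - 1 \<in> I" "gen GammaInv * gen Gamma - 1 \<in> I"
    and "gen Alpha * gen Beta - gen Beta * gen Alpha - s * gen Alpha \<in> I"
    "gen Alpha * gen Delta - gen Delta * gen Alpha \<in> I"
    "gen Beta * gen Delta - gen Delta * gen Beta + s * gen Delta \<in> I"
    unfolding I_def s_def
    by (auto intro!: rel_ideal_gen simp: hq_rels_def gamma_rels_def commutator_def)
  let ?K = "gen GammaInv" and ?G = "gen Gamma" and ?x = "gen x"
  have "?K * ?x - ?x * ?K = - (?K * (?G * ?x - ?x * ?G) * ?K) - ?K * ?x * (?G * ?K - 1) + (?K * ?G - 1) * ?x * ?K"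
    by (simp add: algebra_simps)
  moreover have "?K * (?G * ?x - ?x * ?G) * ?K \<in> I" "?K * ?x * (?G * ?K - 1) \<in> I" "(?K * ?G - 1) * ?x * ?K \<in> I"
    using G GK unfolding I_def by (simp_all only: rel_ideal_left rel_ideal_right mult.assoc[of _ ?x ?K])
  ultimately show "?K * ?x - ?x * ?K \<in> I"
    unfolding I_def by (simp only: rel_ideal_add rel_ideal_diff rel_ideal_uminus)
qed

lemma hq_relsE:
  assumes "r \<in> hq_rels \<omega>"
    and "P (gen Gamma * gen GammaInv - 1)" "P (gen GammaInv * gen Gamma - 1)"
    and "\<And>x. P (gen Gamma * gen x - gen x * gen Gamma)"
    and "P (gen Alpha * gen Beta - gen Beta * gen Alpha - scalar (\<omega> / 2) * gen Alpha)"
    and "P (gen Alpha * gen Delta - gen Delta * gen Alpha)"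
    and "P (gen Beta * gen Delta - gen Delta * gen Beta + scalar (\<omega> / 2) * gen Delta)"
  shows "P r"
  using assms(1) unfolding hq_rels_def gamma_rels_def commutator_def
  by (elim UnE insertE emptyE CollectE exE conjE) (simp_all only: assms)

lemma hq_comult_rels:
  assumes "r \<in> hq_rels \<omega>"
  shows "hom_ext scalar hq_comult_gen r \<in> rel_ideal (tensor_rels (hq_rels \<omega>) (hq_rels \<omega>))"
    (is "_ \<in> ?J")
  using assms
proof (rule hq_relsE)
  let ?a = "gen Alpha" and ?b = "gen Beta" and ?c = "gen Gamma" and ?d = "gen Delta" and ?k = "gen GammaInv"
    and ?s = "scalar (\<omega> / 2) :: heis_gen free_alg"
  let ?D = "hom_ext scalar hq_comult_gen"
  note simps = scalar.hom_ext_simps tensor_simps heis_comult_simps[unfolded One_nat_def] algebra_simps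
  note J = rel_ideal_add rel_ideal_zero rel_ideal_diff tensor_ideal_left tensor_ideal_right hq_members
  have "?D (?c * ?k - 1) = (?c * ?k - 1) \<boxtimes> (?c * ?k) + 1 \<boxtimes> (?c * ?k - 1)"
    by (simp add: simps)
  also have "\<dots> \<in> ?J" by (simp add: J)
  finally show "?D (?c * ?k - 1) \<in> ?J" .
  have "?D (?k * ?c - 1) = (?k * ?c - 1) \<boxtimes> (?k * ?c) + 1 \<boxtimes> (?k * ?c - 1)"
    by (simp add: simps)
  also have "\<dots> \<in> ?J" by (simp add: J)
  finally show "?D (?k * ?c - 1) \<in> ?J" .
  show "?D (?c * gen x - gen x * ?c) \<in> ?J" for x
  proof -
  have "?D (?c * gen x - gen x * ?c) = (case x of
      Alpha \<Rightarrow> ?c \<boxtimes> (?c * ?a - ?a * ?c) + (?c * ?a - ?a * ?c) \<boxtimes> (?c * ?c)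
    | Beta \<Rightarrow> ?c \<boxtimes> (?c * ?b - ?b * ?c) + (?c * ?a - ?a * ?c) \<boxtimes> (?c * ?d) + (?a * ?c) \<boxtimes> (?c * ?d - ?d * ?c) + (?c * ?b - ?b * ?c) \<boxtimes> ?c
    | Gamma \<Rightarrow> 0
    | Delta \<Rightarrow> (?c * ?c) \<boxtimes> (?c * ?d - ?d * ?c) + (?c * ?d - ?d * ?c) \<boxtimes> ?c
    | GammaInv \<Rightarrow> (?c * ?k - ?k * ?c) \<boxtimes> (?c * ?k) + (?k * ?c) \<boxtimes> (?c * ?k - ?k * ?c))"
    by (cases x) (simp_all add: simps)
  also have "\<dots> \<in> ?J" by (cases x) (simp_all add: J)
  finally show ?thesis .
  qed
  have "?D (?a * ?b - ?b * ?a - ?s * ?a) =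
      1 \<boxtimes> (?a * ?b - ?b * ?a - ?s * ?a) + (?a * ?b - ?b * ?a - ?s * ?a) \<boxtimes> ?c
      + ?a \<boxtimes> (?a * ?d - ?d * ?a) + ?a \<boxtimes> (?c * ?b - ?b * ?c) + (?a * ?a) \<boxtimes> (?c * ?d - ?d * ?c)"
    by (simp add: simps)
  also have "\<dots> \<in> ?J" by (simp add: J)
  finally show "?D (?a * ?b - ?b * ?a - ?s * ?a) \<in> ?J" .
  have "?D (?a * ?d - ?d * ?a) = ?c \<boxtimes> (?a * ?d - ?d * ?a) + (?a * ?c) \<boxtimes> (?c * ?d - ?d * ?c)
      - (?c * ?a - ?a * ?c) \<boxtimes> (?d * ?c) + (?a * ?d - ?d * ?a) \<boxtimes> ?c"
    by (simp add: simps)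
  also have "\<dots> \<in> ?J" by (simp add: J del: minus_diff_eq)
  finally show "?D (?a * ?d - ?d * ?a) \<in> ?J" .
  have "?D (?b * ?d - ?d * ?b + ?s * ?d) =
     ?c \<boxtimes> (?b * ?d - ?d * ?b + ?s * ?d) + (?b * ?d - ?d * ?b + ?s * ?d) \<boxtimes> 1
     - (?c * ?a - ?a * ?c) \<boxtimes> (?d * ?d) + (?a * ?d - ?d * ?a) \<boxtimes> ?d - (?c * ?b - ?b * ?c) \<boxtimes> ?d"
    by (simp add: simps)
  also have "\<dots> \<in> ?J" by (simp add: J del: minus_diff_eq)
  finally show "?D (?b * ?d - ?d * ?b + ?s * ?d) \<in> ?J" .
qed

lemma hq_counit_rels: "r \<in> hq_rels \<omega> \<Longrightarrow> hom_ext id hq_counit_gen r = 0"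
  by (erule hq_relsE[where P = "\<lambda>r. hom_ext id hq_counit_gen r = 0"]) (simp_all add: cnt.hom_ext_simps)

lemma hq_antipode_rels:
  assumes "r \<in> hq_rels \<omega>"
  shows "antihom_ext scalar hq_antipode_gen r \<in> rel_ideal (hq_rels \<omega>)"
    (is "_ \<in> ?I")
  using assms
proof (rule hq_relsE)
  let ?a = "gen Alpha" and ?b = "gen Beta" and ?c = "gen Gamma" and ?d = "gen Delta" and ?k = "gen GammaInv"
    and ?s = "scalar (\<omega> / 2) :: heis_gen free_alg"
  let ?S = "antihom_ext scalar hq_antipode_gen"
  note simps = scalar.antihom_ext_simps
  note J = rel_ideal_add rel_ideal_zero rel_ideal_diff rel_ideal_uminus
  note m = hq_members[where \<omega> = \<omega>]
  note I = m m[THEN rel_ideal_left] m[THEN rel_ideal_right] m[THEN rel_ideal_left, THEN rel_ideal_right]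
  have sc: "x * ?s = ?s * x" for x by (rule scalar_central)
  have scl: "x * (?s * y) = ?s * (x * y)" for x y using sc[of x] by (simp only: mult.assoc[symmetric])
  show "?S (?c * ?k - 1) \<in> ?I" "?S (?k * ?c - 1) \<in> ?I"
    using m by (simp_all add: simps)
  show "?S (?c * gen x - gen x * ?c) \<in> ?I" for x
  proof -
  have "?S (?c * gen x - gen x * ?c) = (case x of
      Alpha \<Rightarrow> ?k * (?k * ?a - ?a * ?k)
    | Beta \<Rightarrow> (?k * ?b - ?b * ?k) - ?k * (?k * ?a - ?a * ?k) * ?d - (?k * ?a) * (?k * ?d - ?d * ?k)
    | Gamma \<Rightarrow> 0
    | Delta \<Rightarrow> ?k * (?k * ?d - ?d * ?k)
    | GammaInv \<Rightarrow> ?c * ?k - ?k * ?c)"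
    by (cases x) (simp_all add: simps algebra_simps)
  also have "\<dots> \<in> ?I"
    by (cases x) (simp_all only: J I heis_gen.case)
  finally show ?thesis .
  qed
  have "?S (?a * ?b - ?b * ?a - ?s * ?a) = - (?k * (?a * ?b - ?b * ?a - ?s * ?a)) - (?k * ?b - ?b * ?k) * ?a
      + (?k * ?a * ?k) * (?a * ?d - ?d * ?a) + (?k * ?a) * (?k * ?d - ?d * ?k) * ?a"
    by (simp add: simps algebra_simps sc scl)
  also have "\<dots> \<in> ?I" by (simp only: J I)
  finally show "?S (?a * ?b - ?b * ?a - ?s * ?a) \<in> ?I" .
  have "?S (?a * ?d - ?d * ?a) = - ((?k * ?k) * (?a * ?d - ?d * ?a)) - ?k * (?k * ?d - ?d * ?k) * ?a
     + ?k * (?k * ?a - ?a * ?k) * ?d"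
    by (simp add: simps algebra_simps)
  also have "\<dots> \<in> ?I" by (simp only: J I)
  finally show "?S (?a * ?d - ?d * ?a) \<in> ?I" .
  have "?S (?b * ?d - ?d * ?b + ?s * ?d) = - (?k * (?b * ?d - ?d * ?b + ?s * ?d)) + (?k * ?b - ?b * ?k) * ?d
     + (?k * ?k) * (?a * ?d - ?d * ?a) * ?d - ?k * (?k * ?a - ?a * ?k) * (?d * ?d) - (?k * ?a) * (?k * ?d - ?d * ?k) * ?d
     + ?k * (?k * ?d - ?d * ?k) * (?a * ?d)"
    by (simp add: simps algebra_simps sc scl)
  also have "\<dots> \<in> ?I" by (simp only: J I)
  finally show "?S (?b * ?d - ?d * ?b + ?s * ?d) \<in> ?I" .
qed

lemma hom_descend:
  assumes "\<And>r. r \<in> R \<Longrightarrow> f r \<in> rel_ideal R'"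
    and "\<And>x y. f (x + y) = f x + f y" "\<And>x y. f (x * y) = f x * f y"
  shows "descend (\<lambda>x. cls R' (f x)) (cls R x) = cls R' (f x)"
proof (rule descend_cls)
  have f0: "f 0 = 0" using assms(2)[of 0 0] by simp
  have fd: "f (y - x) = f y - f x" for x y using assms(2)[of "y - x" x] by (simp add: algebra_simps)
  have "f z \<in> rel_ideal R'" if "z \<in> rel_ideal R" for z
    using that by (induction rule: rel_ideal_induct) (simp_all add: assms f0 rel_ideal_intros)
  then show "cls R' (f y) = cls R' (f x)" if "y - x \<in> rel_ideal R" for y
    using that fd by (simp add: cls_eq_iff flip: fd)
qed

lemma antihom_descend:
  assumes "\<And>r. r \<in> R \<Longrightarrow> f r \<in> rel_ideal R'"
    and "\<And>x y. f (x + y) = f x + f y" "\<And>x y. f (x * y) = f y * f x"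
  shows "descend (\<lambda>x. cls R' (f x)) (cls R x) = cls R' (f x)"
proof (rule descend_cls)
  have f0: "f 0 = 0" using assms(2)[of 0 0] by simp
  have fd: "f (y - x) = f y - f x" for x y using assms(2)[of "y - x" x] by (simp add: algebra_simps)
  have "f z \<in> rel_ideal R'" if "z \<in> rel_ideal R" for z
    using that by (induction rule: rel_ideal_induct) (simp_all add: assms f0 rel_ideal_intros)
  then show "cls R' (f y) = cls R' (f x)" if "y - x \<in> rel_ideal R" for y
    using that by (simp add: cls_eq_iff flip: fd)
qed

lemma scalar_descend:
  assumes "\<And>r. r \<in> R \<Longrightarrow> f r = (0::complex)"
    and "\<And>x y. f (x + y) = f x + f y" "\<And>x y. f (x * y) = f x * f y"
  shows "descend f (cls R x) = f x"
proof (rule descend_cls)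
  have f0: "f 0 = 0" using assms(2)[of 0 0] by simp
  have "f z = 0" if "z \<in> rel_ideal R" for z
    using that by (induction rule: rel_ideal_induct) (simp_all add: assms f0)
  then show "f y = f x" if "y - x \<in> rel_ideal R" for y
    using that assms(2)[of "y - x" x] by simp
qed

lemma uq_hopf_cls:
  "comult (uq_hopf \<omega>) (cls (uq_rels \<omega>) x) =
    cls (tensor_rels (uq_rels \<omega>) (uq_rels \<omega>)) (hom_ext scalar uq_comult_gen x)"
  "counit (uq_hopf \<omega>) (cls (uq_rels \<omega>) x) = hom_ext id uq_counit_gen x"
  "antipode (uq_hopf \<omega>) (cls (uq_rels \<omega>) x) =
    cls (uq_rels \<omega>) (antihom_ext scalar uq_antipode_gen x)"
  unfolding uq_hopf_def hopf_str.simps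
  by (rule hom_descend antihom_descend scalar_descend;
      simp add: uq_comult_rels uq_counit_rels uq_antipode_rels scalar.hom_ext_simps
        cnt.hom_ext_simps scalar.antihom_ext_simps)+

lemma hq_hopf_cls:
  "comult (hq_hopf \<omega>) (cls (hq_rels \<omega>) x) =
    cls (tensor_rels (hq_rels \<omega>) (hq_rels \<omega>)) (hom_ext scalar hq_comult_gen x)"
  "counit (hq_hopf \<omega>) (cls (hq_rels \<omega>) x) = hom_ext id hq_counit_gen x"
  "antipode (hq_hopf \<omega>) (cls (hq_rels \<omega>) x) =
    cls (hq_rels \<omega>) (antihom_ext scalar hq_antipode_gen x)"
  unfolding hq_hopf_def hopf_str.simps
  by (rule hom_descend antihom_descend scalar_descend;
      simp add: hq_comult_rels hq_counit_rels hq_antipode_rels scalar.hom_ext_simps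
        cnt.hom_ext_simps scalar.antihom_ext_simps)+

end

theory Submission
  imports Defs
begin

text \<open>
  The generators \<open>A, A\<^sup>\<dagger>, N, H\<close> are (twisted) primitive, so they pair with products by a Leibniz rule
  whose twists are evaluations at the group-like elements \<open>g\<close>, \<open>g\<^sup>-\<^sup>1\<close> and \<open>1\<close>. These evaluations are
  multiplicative and send \<open>\<gamma>, \<gamma>\<^sup>-\<^sup>1\<close> to \<open>1\<close> and \<open>\<alpha>, \<delta>\<close> to \<open>0\<close>, hence the coefficients
  \<open>\<langle>X, S(t\<^sup>i\<^sub>k) t\<^sup>l\<^sub>j\<rangle>\<close> can be read off. The values on \<open>\<gamma>\<^sup>-\<^sup>1\<close>, which are not among the given data, are
  forced by \<open>\<gamma> \<gamma>\<^sup>-\<^sup>1 = 1\<close>. The resulting identities already hold in the free algebra.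
\<close>

lemma finsum_cls:
  assumes "finite A"
  shows "(\<Oplus>\<^bsub>quot_alg R\<^esub>k\<in>A. cls R (f k)) = cls R (sum f A)"
proof -
  interpret ring "quot_alg R" by (rule ring_quot_alg)
  show ?thesis
    using assms
    by (induction A rule: finite_induct) (simp_all add: finsum_insert quot_alg_simps Pi_iff)
qed

text \<open>Both module operations and the antipode act on representatives, so the double sum can be
  computed in the free algebra and projected once at the end.\<close>

lemma coadjoint_cls:
  "coadjoint \<omega> p X i j = cls (bh_rels \<omega>) (\<Sum>k\<in>{1..3}. \<Sum>l\<in>{1..3}.
    scalar (p X (cls (hq_rels \<omega>)
      (antihom_ext scalar hq_antipode_gen (heis_mat i k) * heis_mat l j))) * heis_mat k l)"
  by (simp add: coadjoint_def Let_def hq_hopf_cls quot_alg_simps finsum_cls)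

locale heis_paired =
  fixes \<omega> :: complex
    and p :: "uq_gen free_alg set \<Rightarrow> heis_gen free_alg set \<Rightarrow> complex"
  assumes heis_pairing: "heis_pairing \<omega> p"
begin

text \<open>The pairing pulled back to the free algebras, where the ordinary ring operations and
  simp rules apply.\<close>

definition pair :: "uq_gen free_alg \<Rightarrow> heis_gen free_alg \<Rightarrow> complex"
  where "pair x a = p (cls (uq_rels \<omega>) x) (cls (hq_rels \<omega>) a)"

lemma hopf: "hopf_pairing (uq_rels \<omega>) (uq_hopf \<omega>) (hq_rels \<omega>) (hq_hopf \<omega>) p"
  using heis_pairing by (simp add: heis_pairing_def)

lemma pair_linear:
  "pair (x + y) a = pair x a + pair y a" "pair x (a + b) = pair x a + pair x b"
  "pair (scalar c * x) a = c * pair x a" "pair x (scalar c * a) = c * pair x a"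
  using hopf
  by (auto simp: hopf_pairing_def bilinear_form_def Let_def quot_alg_simps pair_def)

lemma pair_zero_right: "pair x 0 = 0"
  using pair_linear(2)[of x 0 0] by simp

lemma pair_uminus_right: "pair x (- a) = - pair x a"
  using pair_linear(2)[of x a "- a"] by (simp add: pair_zero_right eq_neg_iff_add_eq_0 add.commute)

lemma pair_diff_right: "pair x (a - b) = pair x a - pair x b"
  using pair_linear(2)[of x a "- b"] by (simp add: pair_uminus_right)

lemma pair_one_left: "pair 1 a = hom_ext id hq_counit_gen a"
  using hopf by (simp add: hopf_pairing_def Let_def quot_alg_simps hq_hopf_cls pair_def)

lemma pair_one_right: "pair x 1 = hom_ext id uq_counit_gen x"
  using hopf by (simp add: hopf_pairing_def Let_def quot_alg_simps uq_hopf_cls pair_def)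

text \<open>For fixed \<open>a\<close> and \<open>b\<close>, the form sending \<open>x\<close>,
  \<open>y\<close> to \<open>\<langle>x, a\<rangle>\<langle>y, b\<rangle>\<close> is bilinear on the
  quotient. The functional \<open>T\<close> it induces can therefore be evaluated on a coproduct
  summand by summand.\<close>

lemma pair_mult:
  fixes a b
  defines "T \<equiv> bilin_ext (uq_rels \<omega>) (uq_rels \<omega>)
      (\<lambda>x y. p x (cls (hq_rels \<omega>) a) * p y (cls (hq_rels \<omega>) b))
    \<circ> cls (tensor_rels (uq_rels \<omega>) (uq_rels \<omega>))"
  shows "pair x (a * b) = T (hom_ext scalar uq_comult_gen x)"
    and "T (y \<boxtimes> z) = pair y a * pair z b" and "T (v + w) = T v + T w"
proof -
  show "pair x (a * b) = T (hom_ext scalar uq_comult_gen x)"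
    using hopf
    by (simp add: hopf_pairing_def Let_def quot_alg_simps uq_hopf_cls pair_def T_def)
  show "T (y \<boxtimes> z) = pair y a * pair z b" "T (v + w) = T v + T w"
    unfolding T_def pair_def
    by (rule bilin_ext_tensor; simp add: pair_linear[unfolded pair_def] algebra_simps)+
qed

lemma pair_gen_mult:
  "pair (gen QA) (a * b) = pair (gen Qginv) a * pair (gen QA) b + pair (gen QA) a * pair (gen Qg) b"
  "pair (gen QAd) (a * b) = pair (gen Qginv) a * pair (gen QAd) b + pair (gen QAd) a * pair (gen Qg) b"
  "pair (gen QN) (a * b) = pair (gen QN) a * pair 1 b + pair 1 a * pair (gen QN) b"
  "pair (gen QH) (a * b) = pair (gen QH) a * pair 1 b + pair 1 a * pair (gen QH) b"
  "pair (gen Qg) (a * b) = pair (gen Qg) a * pair (gen Qg) b"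
  "pair (gen Qginv) (a * b) = pair (gen Qginv) a * pair (gen Qginv) b"
  by (simp_all only: pair_mult scalar.hom_ext_gen uq_comult_gen.simps exp_H_simps)

lemma pair_heis_mat:
  assumes "i \<in> {1..3}" "j \<in> {1..3}"
  shows "pair (gen QA) (heis_mat i j) = mat_unit 1 2 i j"
    "pair (gen QAd) (heis_mat i j) = mat_unit 2 3 i j"
    "pair (gen QH) (heis_mat i j) = mat_unit 1 3 i j"
    "pair (gen QN) (heis_mat i j) = mat_unit 2 2 i j"
    "pair (exp_H k) (heis_mat i j) = (if i = j then 1 else 0) + of_int k * \<omega> / 4 * mat_unit 1 3 i j"
  using heis_pairing assms unfolding heis_pairing_def Let_def pair_def by blast+

lemmas pair_heis_mat_gens = pair_heis_mat(1-4) pair_heis_mat(5)[where k = 1, unfolded exp_H_simps]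
  pair_heis_mat(5)[where k = "- 1", unfolded exp_H_simps]

lemma pair_gens:
  assumes "x \<in> {Alpha, Beta, Gamma, Delta}"
  shows "pair (gen QA) (gen x) = (if x = Alpha then 1 else 0)"
    "pair (gen QAd) (gen x) = (if x = Delta then 1 else 0)"
    "pair (gen QH) (gen x) = (if x = Beta then 1 else 0)"
    "pair (gen QN) (gen x) = (if x = Gamma then 1 else 0)"
    "pair (gen Qg) (gen x) = (if x = Gamma then 1 else if x = Beta then \<omega> / 4 else 0)"
    "pair (gen Qginv) (gen x) = (if x = Gamma then 1 else if x = Beta then - \<omega> / 4 else 0)"
  using assms pair_heis_mat_gens[of 1 2] pair_heis_mat_gens[of 1 3]
    pair_heis_mat_gens[of 2 2] pair_heis_mat_gens[of 2 3]
  by (auto simp: heis_mat_simps mat_unit_def)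

lemma pair_Gamma_GammaInv: "pair x (gen Gamma * gen GammaInv) = hom_ext id uq_counit_gen x"
proof -
  have "cls (hq_rels \<omega>) (gen Gamma * gen GammaInv) = cls (hq_rels \<omega>) 1"
    by (simp add: cls_eq_iff hq_members)
  then show ?thesis
    using pair_one_right[of x] by (simp add: pair_def)
qed

text \<open>Applying each product rule to \<open>\<gamma> \<gamma>\<^sup>-\<^sup>1\<close> gives a
  linear equation in which the unknown value has coefficient 1, since \<open>g\<close>,
  \<open>g\<^sup>-\<^sup>1\<close> and 1 all pair with \<open>\<gamma>\<close> to 1. For
  \<open>N\<close> it reads
  \<open>1 + \<langle>N, \<gamma>\<^sup>-\<^sup>1\<rangle> = 0\<close>.\<close>

lemma pair_GammaInv:
  "pair (gen QA) (gen GammaInv) = 0" "pair (gen QAd) (gen GammaInv) = 0"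
  "pair (gen QH) (gen GammaInv) = 0" "pair (gen QN) (gen GammaInv) = - 1"
  "pair (gen Qg) (gen GammaInv) = 1" "pair (gen Qginv) (gen GammaInv) = 1"
  using pair_Gamma_GammaInv[of "gen QA"] pair_Gamma_GammaInv[of "gen QAd"]
    pair_Gamma_GammaInv[of "gen QH"] pair_Gamma_GammaInv[of "gen QN"]
    pair_Gamma_GammaInv[of "gen Qg"] pair_Gamma_GammaInv[of "gen Qginv"]
  by (simp_all add: pair_gen_mult pair_gens pair_one_left cnt.hom_ext_simps
      eq_neg_iff_add_eq_0 add.commute)

lemmas pair_simps = pair_linear pair_zero_right pair_uminus_right pair_diff_right pair_gen_mult pair_gens
  pair_GammaInv pair_one_left pair_one_right cnt.hom_ext_simps

end

theorem corollary4p2: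
  fixes \<omega> :: complex
    and p :: "uq_gen free_alg set \<Rightarrow> heis_gen free_alg set \<Rightarrow> complex"
  assumes "\<omega> \<noteq> 0"
    and "heis_pairing \<omega> p"
  shows "\<forall>i\<in>{1..3}. \<forall>j\<in>{1..3}.
    coadjoint \<omega> p (cls (uq_rels \<omega>) (gen QA)) i j = cls (bh_rels \<omega>) (mat_of
      [[0, 1 - gen Gamma, - gen Delta],
       [0, 0,             0          ],
       [0, 0,             0          ]] i j) \<and>
    coadjoint \<omega> p (cls (uq_rels \<omega>) (gen QAd)) i j = cls (bh_rels \<omega>) (mat_of
      [[0, 0, gen Alpha    ],
       [0, 0, gen Gamma - 1],
       [0, 0, 0            ]] i j) \<and>
    coadjoint \<omega> p (cls (uq_rels \<omega>) (gen QN)) i j = cls (bh_rels \<omega>) (mat_of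
      [[0, gen Alpha, 0          ],
       [0, 0,         - gen Delta],
       [0, 0,         0          ]] i j) \<and>
    coadjoint \<omega> p (cls (uq_rels \<omega>) (gen QH)) i j = cls (bh_rels \<omega>) 0"
proof -
  interpret heis_paired \<omega> p
    using assms(2) by unfold_locales
  have coadjoint_pair: "coadjoint \<omega> p (cls (uq_rels \<omega>) x) i j =
      cls (bh_rels \<omega>) (\<Sum>k\<in>{1, 2, 3}. \<Sum>l\<in>{1, 2, 3}.
        scalar (pair x (antihom_ext scalar hq_antipode_gen (heis_mat i k) * heis_mat l j)) *
        heis_mat k l)" for x i j
    by (simp only: coadjoint_cls pair_def idx3)
  show ?thesis
    unfolding coadjoint_pair idx3
    \<comment> \<open>Few of the nine summands survive in each entry. For \<open>A\<close> at (1,2),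
      \<open>k = l = 1\<close> contributes \<open>\<langle>A, \<alpha>\<rangle> = 1\<close>, and
      \<open>k = l = 2\<close> contributes \<open>\<langle>A, - \<gamma>\<^sup>-\<^sup>1 \<alpha>
      \<gamma>\<rangle> \<gamma> = - \<gamma>\<close>.\<close>
    by (simp add: heis_mat_simps mat_of_def scalar.antihom_ext_simps pair_simps scalar_simps)
qed

end
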